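(* Let $(\Omega,d,\mu)$ be a metric measure space, let $X$ and $Y$ be r.i. spaces on $\Omega$, and let $0<\alpha\le1$. Assume that there is a constant $C>0$ such that $$\|f\|_Y\le C\,\|f\|_{\dot M^{\alpha,X}}$$ for every boundedly supported Lipschitz function $f$ on $\Omega$. For $x\in\Omega$, $r>0$ and $j=0,1,2,\dots$ put $$r_j=\frac r2+\frac r{2^{j+1}},\qquad a_j=\mu(B(x,r_j)),\qquad \delta_j=r_j-r_{j+1}=\frac r{2^{j+2}} .$$ Then there are constants $C_1,c_1>0$, independent of $x$, $r$ and $j$, such that for all $x\in\Omega$, $r>0$, $j\ge0$, $$\varphi_Y(a_{j+1})\le C_1\,\delta_j^{-\alpha}\varphi_X(a_j),$$ and consequently $$a_j\ge c_1\,\delta_j^\alpha\,a_{j+1}\,\frac{\varphi_Y(a_{j+1})}{\varphi_X(a_{j+1})} .$$ In particular, if there exist $0<\beta\le1$ and $c>0$ such that $$\varphi_Y(t)\ge c\,t^{-\beta}\varphi_X(t),\qquad t>0,$$ then there is $c'>0$ such that $h_\mu(r):=\inf_{x\in\Omega}\mu(B(x,r))\ge c'\,r^{\alpha/\beta}$ for all $r>0$. If instead the inequality $\varphi_Y(t)\ge c\,t^{-\beta}\varphi_X(t)$ is assumed only for $0<t\le t_0$ (for some $t_0>0$), then there is $c'>0$ such that $h_\mu(r)\ge c'\,r^{\alpha/\beta}$ for all $0<r\le1$.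
   Context: Metric measure space: $(\Omega,d)$ is a separable metric space, $\mu$ is a nonatomic Borel measure on $\Omega$ (in particular $\mu(\{x\})=0$ for all $x$) with $\mu(\Omega)=\infty$ and $0<\mu(B)<\infty$ for every open ball $B=B(x,r)=\{y:d(x,y)<r\}$. R.i. space: with $f^*(t)=\inf\{\lambda\ge0:\mu\{|f|>\lambda\}\le t\}$, an r.i. space is a Banach space $X$ of ($\mu$-a.e. classes of) measurable functions with the lattice property ($|f|\le|g|$, $g\in X$ imply $f\in X$, $\|f\|_X\le\|g\|_X$), the Fatou property ($0\le f_n\uparrow f$ a.e. implies $\|f_n\|_X\uparrow\|f\|_X$), and rearrangement invariance ($f^*=g^*$, $f\in X$ imply $g\in X$, $\|g\|_X=\|f\|_X$); one has $L^1\cap L^\infty\subset X\subset L^1+L^\infty$ continuously. Fundamental function: $\varphi_X(t)=\|\chi_E\|_X$ for any measurable $E$ with $\mu(E)=t$; it is quasi-concave ($\varphi_X$ increasing, $\varphi_X(t)/t$ decreasing). Haj\l asz seminorm: $D^\alpha(f)$ is the set of nonnegative measurable $g$ with $|f(x)-f(y)|\le d(x,y)^\alpha(g(x)+g(y))$ for $\mu$-a.e. $x,y$, and $\|f\|_{\dot M^{\alpha,X}}=\inf_{g\in D^\alpha(f)}\|g\|_X$. *)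

theory Defs
  imports "HOL-Probability.Essential_Supremum"
begin

locale metric_measure_space =
  fixes M :: "'a::metric_space measure"
  assumes separable: "separable_space (euclidean :: 'a topology)"
    and sets_eq_borel: "sets M = sets borel"
    and nonatomic: "\<not> (\<exists>A \<in> sets M. emeasure M A > 0 \<and>
          (\<forall>B \<in> sets M. B \<subseteq> A \<longrightarrow> emeasure M B = 0 \<or> emeasure M (A - B) = 0))"
    and infinite_measure: "emeasure M UNIV = \<infinity>"
    and ball_pos: "r > 0 \<Longrightarrow> 0 < emeasure M (ball x r)"
    and ball_finite: "r > 0 \<Longrightarrow> emeasure M (ball x r) < \<infinity>"

definition h_mu :: "'a::metric_space measure \<Rightarrow> real \<Rightarrow> real"
  where "h_mu M r = (INF x. measure M (ball x r))"

definition decr_rearr :: "'a measure \<Rightarrow> ('a \<Rightarrow> real) \<Rightarrow> real \<Rightarrow> ennreal"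
  where "decr_rearr M f t =
    Inf {ennreal l | l. 0 \<le> l \<and> emeasure M {x \<in> space M. \<bar>f x\<bar> > l} \<le> ennreal t}"

definition L1_norm :: "'a measure \<Rightarrow> ('a \<Rightarrow> real) \<Rightarrow> ennreal"
  where "L1_norm M f = (\<integral>\<^sup>+ x. ennreal \<bar>f x\<bar> \<partial>M)"

definition Linf_norm :: "'a measure \<Rightarrow> ('a \<Rightarrow> real) \<Rightarrow> ennreal"
  where "Linf_norm M f = esssup M (\<lambda>x. ennreal \<bar>f x\<bar>)"

definition L1_cap_Linf_norm :: "'a measure \<Rightarrow> ('a \<Rightarrow> real) \<Rightarrow> ennreal"
  where "L1_cap_Linf_norm M f = max (L1_norm M f) (Linf_norm M f)"

definition L1_plus_Linf_norm :: "'a measure \<Rightarrow> ('a \<Rightarrow> real) \<Rightarrow> ennreal"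
  where "L1_plus_Linf_norm M f =
    Inf {L1_norm M g + Linf_norm M h | g h.
      g \<in> borel_measurable M \<and> h \<in> borel_measurable M \<and> (AE x in M. f x = g x + h x)}"

text \<open>
  A space X of measurable functions is represented by its norm, extended by the value
  infinity to the measurable functions outside X; X itself is \<open>carrier_of M N\<close>.
  Almost everywhere classes are handled by working with representatives: \<open>lattice\<close> makes
  the norm invariant under changes on null sets.
\<close>

definition carrier_of :: "'a measure \<Rightarrow> (('a \<Rightarrow> real) \<Rightarrow> ennreal) \<Rightarrow> ('a \<Rightarrow> real) set"
  where "carrier_of M N = {f \<in> borel_measurable M. N f < \<infinity>}"

text \<open>
  The two embedding conditions follow from the others as soon as X contains a function that is
  not a.e. zero (for nonatomic \<open>\<sigma>\<close>-finite measures of infinite total mass); listing them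
  excludes the trivial space.
\<close>

locale ri_space =
  fixes M :: "'a measure" and N :: "('a \<Rightarrow> real) \<Rightarrow> ennreal"
  assumes definite: "f \<in> borel_measurable M \<Longrightarrow> N f = 0 \<longleftrightarrow> (AE x in M. f x = 0)"
    and homogeneous: "f \<in> carrier_of M N \<Longrightarrow> N (\<lambda>x. a * f x) = ennreal \<bar>a\<bar> * N f"
    and triangle: "f \<in> carrier_of M N \<Longrightarrow> g \<in> carrier_of M N \<Longrightarrow>
          N (\<lambda>x. f x + g x) \<le> N f + N g"
    and complete: "(\<And>n. F n \<in> carrier_of M N) \<Longrightarrow>
          (\<And>e::real. e > 0 \<Longrightarrow>
             \<exists>K. \<forall>m\<ge>K. \<forall>n\<ge>K. N (\<lambda>x. F m x - F n x) < ennreal e) \<Longrightarrow>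
          \<exists>f \<in> carrier_of M N. (\<lambda>n. N (\<lambda>x. F n x - f x)) \<longlonglongrightarrow> 0"
    and lattice: "f \<in> borel_measurable M \<Longrightarrow> g \<in> borel_measurable M \<Longrightarrow>
          (AE x in M. \<bar>f x\<bar> \<le> \<bar>g x\<bar>) \<Longrightarrow> N f \<le> N g"
    and fatou: "(\<And>n. F n \<in> borel_measurable M) \<Longrightarrow> f \<in> borel_measurable M \<Longrightarrow>
          (AE x in M. (\<forall>n. 0 \<le> F n x) \<and> incseq (\<lambda>n. F n x) \<and> (\<lambda>n. F n x) \<longlonglongrightarrow> f x) \<Longrightarrow>
          (\<lambda>n. N (F n)) \<longlonglongrightarrow> N f"
    and rearrangement_invariant: "f \<in> borel_measurable M \<Longrightarrow> g \<in> borel_measurable M \<Longrightarrow>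
          (\<And>t. t \<ge> 0 \<Longrightarrow> decr_rearr M f t = decr_rearr M g t) \<Longrightarrow> N f = N g"
    and L1_cap_Linf_embeds: "\<exists>c>0::real. \<forall>f \<in> borel_measurable M.
          N f \<le> ennreal c * L1_cap_Linf_norm M f"
    and embeds_L1_plus_Linf: "\<exists>c>0::real. \<forall>f \<in> borel_measurable M.
          L1_plus_Linf_norm M f \<le> ennreal c * N f"

text \<open>
  The choice of the set is immaterial and the value is finite, see \<open>fundamental_fun_eq\<close> below.
\<close>

definition fundamental_fun :: "'a measure \<Rightarrow> (('a \<Rightarrow> real) \<Rightarrow> ennreal) \<Rightarrow> real \<Rightarrow> real"
  where "fundamental_fun M N t =
    enn2real (N (indicator (SOME E. E \<in> sets M \<and> emeasure M E = ennreal t)))"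

lemma decr_rearr_indicator_cong:
  assumes "E \<in> sets M" "F \<in> sets M" "emeasure M E = emeasure M F"
  shows "decr_rearr M (indicator E) t = decr_rearr M (indicator F) t"
proof -
  have *: "{x \<in> space M. \<bar>indicator A x :: real\<bar> > l} = (if l < 1 then A else {})"
    if "A \<in> sets M" "0 \<le> l" for A and l :: real
    using that sets.sets_into_space[OF that(1)] by (auto simp: indicator_def split: if_splits)
  have "(0 \<le> l \<and> emeasure M {x \<in> space M. \<bar>indicator E x :: real\<bar> > l} \<le> ennreal t) \<longleftrightarrow>
        (0 \<le> l \<and> emeasure M {x \<in> space M. \<bar>indicator F x :: real\<bar> > l} \<le> ennreal t)" for l
    using * assms by (cases "0 \<le> l") simp_all
  then show ?thesis
    unfolding decr_rearr_def by presburger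
qed

lemma (in ri_space) indicator_in_carrier:
  assumes "E \<in> sets M" "emeasure M E < \<infinity>"
  shows "indicator E \<in> carrier_of M N"
proof -
  obtain c :: real where c: "\<forall>f \<in> borel_measurable M. N f \<le> ennreal c * L1_cap_Linf_norm M f"
    using L1_cap_Linf_embeds by blast
  have m: "(indicator E :: 'a \<Rightarrow> real) \<in> borel_measurable M"
    using assms by simp
  have "L1_norm M (indicator E) = emeasure M E"
    using assms by (simp add: L1_norm_def ennreal_indicator)
  moreover have "Linf_norm M (indicator E) \<le> 1"
    unfolding Linf_norm_def
    by (rule esssup_I) (use assms in \<open>auto simp: indicator_def\<close>)
  ultimately have "L1_cap_Linf_norm M (indicator E) < \<infinity>"
    using assms(2) by (auto simp: L1_cap_Linf_norm_def intro: le_less_trans)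
  then have "ennreal c * L1_cap_Linf_norm M (indicator E) < \<infinity>"
    by (simp add: ennreal_mult_less_top)
  then show ?thesis
    using m c le_less_trans by (fastforce simp: carrier_of_def)
qed

lemma (in ri_space) fundamental_fun_eq:
  assumes "E \<in> sets M" "emeasure M E = ennreal t"
  shows "ennreal (fundamental_fun M N t) = N (indicator E)"
proof -
  define F where "F = (SOME E. E \<in> sets M \<and> emeasure M E = ennreal t)"
  have F: "F \<in> sets M \<and> emeasure M F = ennreal t"
    unfolding F_def by (rule someI[where x = E]) (use assms in auto)
  have "N (indicator F) = N (indicator E)"
    by (rule rearrangement_invariant) (use F assms in \<open>auto intro: decr_rearr_indicator_cong\<close>)
  moreover have "N (indicator E) < \<infinity>"
    using indicator_in_carrier[of E] assms by (simp add: carrier_of_def)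
  ultimately show ?thesis
    by (simp add: fundamental_fun_def F_def[symmetric])
qed

text \<open>
  ``For almost all x, y'' means: for all x, y outside a common null set.
\<close>

definition hajlasz_gradients ::
    "'a::metric_space measure \<Rightarrow> real \<Rightarrow> ('a \<Rightarrow> real) \<Rightarrow> ('a \<Rightarrow> real) set"
  where "hajlasz_gradients M \<alpha> f = {g \<in> borel_measurable M. (\<forall>x. 0 \<le> g x) \<and>
    (\<exists>Z \<in> null_sets M. \<forall>x. \<forall>y. x \<notin> Z \<longrightarrow> y \<notin> Z \<longrightarrow>
       \<bar>f x - f y\<bar> \<le> dist x y powr \<alpha> * (g x + g y))}"

definition hajlasz_seminorm ::
    "'a::metric_space measure \<Rightarrow> real \<Rightarrow> (('a \<Rightarrow> real) \<Rightarrow> ennreal) \<Rightarrow> ('a \<Rightarrow> real) \<Rightarrow> ennreal"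
  where "hajlasz_seminorm M \<alpha> N f = (INF g \<in> hajlasz_gradients M \<alpha> f. N g)"

definition radius_seq :: "real \<Rightarrow> nat \<Rightarrow> real"
  where "radius_seq r j = r / 2 + r / 2 ^ (j + 1)"

lemma radius_seq_diff: "radius_seq r j - radius_seq r (Suc j) = r / 2 ^ (j + 2)"
  by (simp add: radius_seq_def field_simps)

end

theory Submission
  imports Defs "HOL-Probability.Distribution_Functions"
begin

text \<open>
  Testing the inequality on the Lipschitz cutoff between \<open>ball x r\<^sub>j\<^sub>+\<^sub>1\<close> and \<open>ball x r\<^sub>j\<close>, whose
  gradient is \<open>\<delta>\<^sub>j powr (-\<alpha>)\<close> on the larger ball, gives the first estimate. Splitting the larger
  ball into pieces of the measure of the smaller one (possible in the absence of atoms) gives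
  \<open>\<phi>\<^sub>X(a\<^sub>j) / a\<^sub>j \<le> 2 \<phi>\<^sub>X(a\<^sub>j\<^sub>+\<^sub>1) / a\<^sub>j\<^sub>+\<^sub>1\<close>, hence the second. Under the growth condition the second
  estimate is a linear recursion for \<open>ln a\<^sub>j\<close>, which is bounded below by \<open>ln (\<mu> (ball x (r/2)))\<close>;
  iterating it removes the unknown lower bound because \<open>(1 - \<beta>) ^ n\<close> tends to 0.
\<close>

section \<open>Coding sets of naturals by ternary digits\<close>

lemma summable_ternary_digits:
  "summable (\<lambda>n. indicator A n * (1 / 3) ^ n :: real)"
  by (rule summable_comparison_test'[of "\<lambda>n. (1 / 3 :: real) ^ n" 0])
     (auto simp: indicator_def summable_geometric)

text \<open>At the first index \<open>n\<close> where two sets differ, one sum gains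
  \<open>(1 / 3) ^ n\<close>, while all later digits of the other contribute at most half of that.
  Base 3 with digits 0 and 1 thus avoids the double expansions of base 2.\<close>

lemma inj_ternary_digits:
  "inj (\<lambda>A :: nat set. \<Sum>n. indicator A n * (1 / 3) ^ n :: real)"
proof -
  define T where "T A = (\<Sum>n. indicator A n * (1 / 3) ^ n :: real)" for A :: "nat set"
  have less: "T B < T A" if "\<And>k. k < n \<Longrightarrow> k \<in> A \<longleftrightarrow> k \<in> B" "n \<in> A" "n \<notin> B"
    for A B and n :: nat
  proof -
    note sA = summable_ternary_digits[of A]
    note sB = summable_ternary_digits[of B]
    have tail: "(\<lambda>k. (1 / 3 :: real) ^ (k + Suc n)) sums ((1 / 3) ^ Suc n * (1 / (1 - 1 / 3)))"
      using sums_mult[OF geometric_sums[of "1 / 3 :: real"], of "(1 / 3) ^ Suc n"]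
      by (simp add: power_add mult_ac)
    have "(\<Sum>k. indicator B (k + Suc n) * (1 / 3) ^ (k + Suc n) :: real)
        \<le> (\<Sum>k. (1 / 3) ^ (k + Suc n))"
      by (rule suminf_le[OF _ summable_ignore_initial_segment[OF sB] sums_summable[OF tail]])
         (auto simp: indicator_def)
    also have "\<dots> = (1 / 3) ^ n * (1 / 2)"
      using sums_unique[OF tail] by simp
    also have "\<dots> < (1 / 3) ^ n"
      by simp
    finally have *: "(\<Sum>k. indicator B (k + Suc n) * (1 / 3) ^ (k + Suc n) :: real) < (1 / 3) ^ n" .
    have "0 \<le> (\<Sum>k. indicator A (k + Suc n) * (1 / 3) ^ (k + Suc n) :: real)"
      by (rule suminf_nonneg[OF summable_ignore_initial_segment[OF sA]]) auto
    moreover have "(\<Sum>k<n. indicator A k * (1 / 3) ^ k :: real) = (\<Sum>k<n. indicator B k * (1 / 3) ^ k)"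
      by (rule sum.cong) (use that in \<open>auto simp: indicator_def\<close>)
    ultimately show ?thesis
      using * that(2,3) suminf_split_initial_segment[OF sA, of "Suc n"]
        suminf_split_initial_segment[OF sB, of "Suc n"]
      by (simp add: T_def)
  qed
  have "A = B" if eq: "T A = T B" for A B
  proof (rule ccontr)
    assume "A \<noteq> B"
    then have ex: "\<exists>n. (n \<in> A) \<noteq> (n \<in> B)"
      by blast
    define n where "n = (LEAST n. (n \<in> A) \<noteq> (n \<in> B))"
    have n: "(n \<in> A) \<noteq> (n \<in> B)"
      unfolding n_def by (rule LeastI_ex[OF ex])
    have "k \<in> A \<longleftrightarrow> k \<in> B" if "k < n" for k
      using not_less_Least[of k] that unfolding n_def by blast
    then show False
      using n less[of n A B] less[of n B A] eq by auto
  qed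
  then show ?thesis
    unfolding T_def[abs_def, symmetric] by (rule injI)
qed

section \<open>Subsets of prescribed measure\<close>

context metric_measure_space
begin

lemma space_eq_UNIV: "space M = UNIV"
  using sets_eq_imp_space_eq[OF sets_eq_borel] by simp

lemma ball_in_sets [measurable, simp]: "ball x r \<in> sets M"
  by (simp add: sets_eq_borel)

lemma emeasure_singleton: "emeasure M {x} = 0"
proof (rule ccontr)
  assume "emeasure M {x} \<noteq> 0"
  then have "{x} \<in> sets M \<and> emeasure M {x} > 0 \<and>
      (\<forall>B \<in> sets M. B \<subseteq> {x} \<longrightarrow> emeasure M B = 0 \<or> emeasure M ({x} - B) = 0)"
    by (auto simp: sets_eq_borel subset_singleton_iff zero_less_iff_neq_zero)
  then show False
    using nonatomic by blast
qed

text \<open>Separability gives countably many balls that separate points. The value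
  \<open>h x\<close> records in its ternary digits which of these balls contain \<open>x\<close>, so
  it determines \<open>x\<close>.\<close>

lemma ex_inj_borel_measurable:
  obtains h :: "'a \<Rightarrow> real" where "h \<in> borel_measurable M" "inj h"
proof -
  obtain D :: "'a set" where D: "countable D" "closure D = UNIV"
    using separable by (auto simp: separable_space_def)
  have "D \<noteq> {}"
    using D by auto
  define \<B> where "\<B> = (\<lambda>(q, n). ball q (1 / Suc n)) ` (D \<times> UNIV)"
  have \<B>: "countable \<B>" "\<B> \<noteq> {}" "\<B> \<subseteq> sets M"
    using D(1) \<open>D \<noteq> {}\<close> by (auto simp: \<B>_def sets_eq_borel)
  define E where "E n = from_nat_into \<B> n" for n
  have range_E: "range E = \<B>"
    unfolding E_def using \<B> by (simp add: range_from_nat_into)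
  then have E [measurable]: "E n \<in> sets M" for n
    using \<B>(3) by auto
  define h where "h x = (\<Sum>n. indicator {n. x \<in> E n} n * (1 / 3) ^ n :: real)" for x
  \<comment> \<open>Reading the digit as \<open>indicator (E n) x\<close> makes each term a
    measurable function of \<open>x\<close>.\<close>
  have "(\<lambda>x. \<Sum>n. indicator (E n) x * (1 / 3) ^ n :: real) \<in> borel_measurable M"
    by measurable
  then have "h \<in> borel_measurable M"
    by (simp add: h_def[abs_def] indicator_def)
  moreover have "inj h"
  proof (rule injI)
    fix x y
    assume "h x = h y"
    then have eq: "{n. x \<in> E n} = {n. y \<in> E n}"
      unfolding h_def by (rule injD[OF inj_ternary_digits])
    show "x = y"
    proof (rule ccontr)
      assume "x \<noteq> y"
      then have "0 < dist x y / 2"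
        by simp
      \<comment> \<open>A ball of radius below half the distance from \<open>x\<close> to
        \<open>y\<close> cannot contain both points.\<close>
      then obtain n where n: "inverse (real (Suc n)) < dist x y / 2"
        using reals_Archimedean by blast
      obtain q where q: "q \<in> D" "dist q x < 1 / Suc n"
        using D(2) closure_approachable[of x D]
        by (metis UNIV_I of_nat_0_less_iff zero_less_Suc zero_less_divide_1_iff)
      have "ball q (1 / Suc n) \<in> range E"
        unfolding range_E \<B>_def using q(1) by auto
      then obtain k where k: "E k = ball q (1 / Suc n)"
        by auto
      then have "x \<in> E k"
        using q by simp
      then have "y \<in> E k"
        using eq by blast
      then have "dist q y < 1 / Suc n"
        unfolding k by simp
      then show False
        using q(2) n dist_triangle2[of x y q] dist_commute
        by (smt (verit) field_sum_of_halves inverse_eq_divide)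
    qed
  qed
  ultimately show ?thesis
    using that by blast
qed

text \<open>
  An injective Borel function pushes the measure forward to a measure on the line without
  point masses, so its distribution function is continuous and attains every intermediate value.
\<close>

lemma ex_subset_measure_eq:
  assumes A: "A \<in> fmeasurable M" and t: "0 \<le> t" "t \<le> measure M A"
  obtains B where "B \<in> sets M" "B \<subseteq> A" "measure M B = t"
proof (cases "t = 0 \<or> t = measure M A")
  \<comment> \<open>The distribution function need not attain the values 0 and
    \<open>measure M A\<close>, so these are realised directly by the empty set and
    \<open>A\<close>.\<close>
  case True
  then show ?thesis
    using that[of "{}"] that[of A] A by auto
next
  case False
  have A_sets: "A \<in> sets M"
    using A by (rule fmeasurableD)
  obtain h :: "'a \<Rightarrow> real" where h [measurable]: "h \<in> borel_measurable M" and "inj h"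
    by (rule ex_inj_borel_measurable)
  \<comment> \<open>The whole space has infinite measure; restricting to \<open>A\<close> gives the
    finite measure that a distribution function requires.\<close>
  define R where "R = restrict_space M A"
  have hR [measurable]: "h \<in> borel_measurable R"
    unfolding R_def by (rule measurable_restrict_space1) simp
  have spR: "space R = A"
    by (simp add: R_def space_restrict_space space_eq_UNIV)
  interpret R: finite_measure R
    by (rule finite_measureI)
       (use fmeasurableD2[OF A] A_sets in \<open>simp add: spR, simp add: R_def emeasure_restrict_space space_eq_UNIV\<close>)
  define \<nu> where "\<nu> = distr R borel h"
  interpret \<nu>: finite_borel_measure \<nu>
    using R.finite_measure_distr[OF hR]
    by (simp add: finite_borel_measure_def finite_borel_measure_axioms_def \<nu>_def)
  have \<nu>_eq: "measure \<nu> S = measure M (h -` S \<inter> A)" if "S \<in> sets borel" for S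
  proof -
    have "measure \<nu> S = measure R (h -` S \<inter> A)"
      using that by (simp add: \<nu>_def measure_distr spR)
    also have "\<dots> = measure M (h -` S \<inter> A)"
      unfolding R_def using A_sets by (intro measure_restrict_space) (auto simp: space_eq_UNIV)
    finally show ?thesis .
  qed
  \<comment> \<open>A fibre of the injective \<open>h\<close> has at most one point, hence measure
    0.\<close>
  have "measure \<nu> {u} = 0" for u
  proof -
    have "h -` {u} \<inter> A = {} \<or> (\<exists>x. h -` {u} \<inter> A = {x})"
      using \<open>inj h\<close> by (auto simp: inj_def) blast
    then have "measure M (h -` {u} \<inter> A) = 0"
      using emeasure_singleton by (auto simp: measure_def)
    then show ?thesis
      by (simp add: \<nu>_eq)
  qed
  then have cont: "isCont (cdf \<nu>) u" for u
    by (simp add: \<nu>.isCont_cdf)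
  have "measure \<nu> (space \<nu>) = measure M A"
    using \<nu>_eq[of UNIV] by (simp add: \<nu>_def)
  then have "eventually (\<lambda>u. t < cdf \<nu> u) at_top"
    using order_tendstoD(1)[OF \<nu>.cdf_lim_at_top, of t] False t by simp
  moreover have "eventually (\<lambda>u. cdf \<nu> u < t) at_bot"
    using order_tendstoD(2)[OF \<nu>.cdf_lim_at_bot, of t] False t by simp
  ultimately obtain u v where uv: "t < cdf \<nu> u" "cdf \<nu> v < t"
    by (metis eventually_at_bot_linorder eventually_at_top_linorder order_refl)
  then have "v \<le> u"
    using \<nu>.cdf_nondecreasing[of u v] by linarith
  then obtain w where "cdf \<nu> w = t"
    using IVT[of "cdf \<nu>" v t u] uv cont by auto
  then have "measure M (h -` {..w} \<inter> A) = t"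
    by (simp add: cdf_def \<nu>_eq)
  moreover have "h -` {..w} \<inter> A \<in> sets M"
    using A_sets measurable_sets[OF h, of "{..w}"] by (simp add: space_eq_UNIV)
  ultimately show ?thesis
    using that by blast
qed

end


section \<open>Monotonicity, positivity and growth of the fundamental function\<close>

lemma fundamental_fun_nonneg [simp]: "0 \<le> fundamental_fun M N t"
  by (simp add: fundamental_fun_def)

lemma (in ri_space) fundamental_fun_fmeasurable:
  assumes "E \<in> fmeasurable M"
  shows "ennreal (fundamental_fun M N (measure M E)) = N (indicator E)"
  using assms by (intro fundamental_fun_eq) (auto simp: emeasure_eq_measure2)

lemma (in ri_space) fundamental_fun_mono:
  assumes "E \<in> sets M" "F \<in> fmeasurable M" "E \<subseteq> F"
  shows "fundamental_fun M N (measure M E) \<le> fundamental_fun M N (measure M F)"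
proof -
  have "E \<in> fmeasurable M"
    using assms by (meson fmeasurableI2)
  moreover have "N (indicator E) \<le> N (indicator F)"
    using assms by (intro lattice) (auto simp: indicator_def)
  ultimately have "ennreal (fundamental_fun M N (measure M E)) \<le> ennreal (fundamental_fun M N (measure M F))"
    using assms by (simp add: fundamental_fun_fmeasurable)
  then show ?thesis
    by simp
qed

lemma (in ri_space) fundamental_fun_pos:
  assumes "E \<in> fmeasurable M" "0 < measure M E"
  shows "0 < fundamental_fun M N (measure M E)"
proof -
  have E: "E \<in> sets M"
    using assms(1) by auto
  have "N (indicator E) \<noteq> 0"
  proof
    assume "N (indicator E) = 0"
    then have "AE x in M. indicator E x = (0 :: real)"
      using definite E by (metis borel_measurable_indicator)
    then have "AE x in M. x \<notin> E"
      by eventually_elim (simp add: indicator_eq_0_iff)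
    then have "emeasure M E = 0"
      using E by (simp add: AE_iff_measurable[OF E] AE_iff_null_sets null_setsD1)
    then show False
      using assms(2) by (simp add: measure_def)
  qed
  then show ?thesis
    using fundamental_fun_fmeasurable[OF assms(1)]
    by (metis ennreal_eq_0_iff not_le)
qed

lemma (in ri_space) fundamental_fun_zero: "fundamental_fun M N 0 = 0"
proof -
  have "N (indicator {}) = 0"
    by (subst definite) auto
  then show ?thesis
    using fundamental_fun_fmeasurable[of "{}"]
    by (simp add: ennreal_eq_0_iff order_antisym)
qed

text \<open>Pieces of measure \<open>measure M F\<close> are cut off from \<open>E\<close> one at a
  time, each costing one value of the fundamental function by the triangle inequality. Once the
  remainder has measure at most \<open>measure M F\<close>, it is replaced by a subset of
  \<open>F\<close> of equal measure and monotonicity applies.\<close>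

lemma (in metric_measure_space) fundamental_fun_le_mult:
  assumes "ri_space M N" and F: "F \<in> fmeasurable M" and E: "E \<in> fmeasurable M"
    and "measure M E \<le> real n * measure M F"
  shows "fundamental_fun M N (measure M E) \<le> real n * fundamental_fun M N (measure M F)"
proof -
  interpret ri_space M N by fact
  show ?thesis
    using E assms(4)
  proof (induction n arbitrary: E)
    case 0
    then have "measure M E = 0"
      by (simp add: order_antisym)
    then show ?case
      by (simp add: fundamental_fun_zero)
  next
    case (Suc n)
    show ?case
    proof (cases "measure M E \<le> measure M F")
      case True
      then obtain F' where "F' \<in> sets M" "F' \<subseteq> F" "measure M F' = measure M E"
        using ex_subset_measure_eq[OF F measure_nonneg] by blast
      then have "fundamental_fun M N (measure M E) \<le> fundamental_fun M N (measure M F)"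
        using fundamental_fun_mono F by metis
      then show ?thesis
        by (simp add: distrib_right add_increasing2)
    next
      case False
      then obtain E' where E': "E' \<in> sets M" "E' \<subseteq> E" "measure M E' = measure M F"
        using ex_subset_measure_eq[OF Suc.prems(1), of "measure M F"] by auto
      have fm: "E' \<in> fmeasurable M" "E - E' \<in> fmeasurable M"
        using E' Suc.prems(1) by (auto intro: fmeasurableI2 fmeasurable_Diff)
      have "measure M (E - E') = measure M E - measure M F"
        using E' Suc.prems(1) by (simp add: measurable_measure_Diff)
      then have IH: "fundamental_fun M N (measure M (E - E'))
          \<le> real n * fundamental_fun M N (measure M F)"
        using Suc.prems(2) by (intro Suc.IH[OF fm(2)]) (simp add: algebra_simps)
      have carrier: "indicator A \<in> carrier_of M N" if "A \<in> fmeasurable M" for A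
        using that by (intro indicator_in_carrier) (auto simp: fmeasurable_def)
      have "(indicator E :: 'a \<Rightarrow> real) = (\<lambda>x. indicator E' x + indicator (E - E') x)"
        using E'(2) by (auto simp: fun_eq_iff split: split_indicator)
      then have "N (indicator E) \<le> N (indicator E') + N (indicator (E - E'))"
        using triangle[OF carrier[OF fm(1)] carrier[OF fm(2)]] by simp
      then have "ennreal (fundamental_fun M N (measure M E))
          \<le> ennreal (fundamental_fun M N (measure M F) + fundamental_fun M N (measure M (E - E')))"
        using fm Suc.prems(1) E'(3)
        by (simp add: fundamental_fun_fmeasurable[symmetric])
      then show ?thesis
        using IH by (simp add: ennreal_plus[symmetric] algebra_simps del: ennreal_plus)
    qed
  qed
qed

text \<open>
  Quasi-concavity up to the factor 2, which comes from rounding the quotient of the measures up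
  to an integer.
\<close>

lemma (in metric_measure_space) fundamental_fun_quasi_concave:
  assumes "ri_space M N" and F: "F \<in> fmeasurable M" and E: "E \<in> fmeasurable M"
    and pos: "0 < measure M F" and le: "measure M F \<le> measure M E"
  shows "fundamental_fun M N (measure M E)
    \<le> 2 * (measure M E / measure M F) * fundamental_fun M N (measure M F)"
proof -
  define n where "n = nat \<lceil>measure M E / measure M F\<rceil>"
  have ge1: "1 \<le> measure M E / measure M F"
    using pos le by simp
  have "measure M E / measure M F \<le> real n"
    unfolding n_def by (rule real_nat_ceiling_ge)
  then have "measure M E \<le> real n * measure M F"
    using pos by (simp add: field_simps)
  then have "fundamental_fun M N (measure M E) \<le> real n * fundamental_fun M N (measure M F)"
    using assms by (intro fundamental_fun_le_mult)
  \<comment> \<open>The quotient is at least 1, so its ceiling is below the quotient plus 1, hence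
    below twice the quotient.\<close>
  also have "real n \<le> 2 * (measure M E / measure M F)"
    using ge1 unfolding n_def by linarith
  then have "real n * fundamental_fun M N (measure M F)
      \<le> 2 * (measure M E / measure M F) * fundamental_fun M N (measure M F)"
    by (rule mult_right_mono) simp
  finally show ?thesis .
qed

section \<open>Testing the embedding on Lipschitz cutoffs\<close>

text \<open>Combines the two bounds on the oscillation of a cutoff, the Lipschitz one and the
  trivial bound 1, into a Hoelder bound of exponent \<alpha>.\<close>

lemma min_one_le_powr:
  fixes u :: real
  assumes "0 \<le> u" "0 < \<alpha>" "\<alpha> \<le> 1"
  shows "min 1 u \<le> u powr \<alpha>"
proof (cases "u \<le> 1")
  case True
  then show ?thesis
    using assms powr_mono'[of \<alpha> 1 u] by (cases "u = 0") auto
next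
  case False
  then show ?thesis
    using assms ge_one_powr_ge_zero[of u \<alpha>] by simp
qed

lemma (in metric_measure_space) ball_fmeasurable: "ball x r \<in> fmeasurable M"
proof (cases "r > 0")
  case True
  then show ?thesis
    using ball_finite by (auto intro: fmeasurableI)
qed (simp add: not_less ball_empty)

lemma (in metric_measure_space) measure_ball_pos:
  assumes "0 < r"
  shows "0 < measure M (ball x r)"
  using ball_pos[OF assms, of x] emeasure_eq_measure2[OF ball_fmeasurable[of x r]] by simp

lemma (in metric_measure_space) fundamental_fun_ball_le:
  assumes "ri_space M NX" "ri_space M NY" and \<alpha>: "0 < \<alpha>" "\<alpha> \<le> 1" and "0 \<le> C"
    and embed: "\<And>f :: 'a \<Rightarrow> real. \<exists>L. L-lipschitz_on UNIV f \<Longrightarrow> bounded {x. f x \<noteq> 0} \<Longrightarrow>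
      NY f \<le> ennreal C * hajlasz_seminorm M \<alpha> NX f"
    and "s < t"
  shows "fundamental_fun M NY (measure M (ball x s))
    \<le> C * (t - s) powr (- \<alpha>) * fundamental_fun M NX (measure M (ball x t))"
proof -
  interpret X: ri_space M NX by fact
  interpret Y: ri_space M NY by fact
  \<comment> \<open>\<open>f\<close> is 1 on \<open>ball x s\<close>, 0 outside
    \<open>ball x t\<close>, and has slope at most \<open>1 / (t - s)\<close> in between.\<close>
  define f where "f y = max 0 (min 1 ((t - dist x y) / (t - s)))" for y
  define g where "g y = (t - s) powr (- \<alpha>) * indicator (ball x t) y" for y
  have f_diff: "\<bar>f y - f z\<bar> \<le> min 1 (dist y z / (t - s))" for y z
  proof -
    have "\<bar>f y - f z\<bar> \<le> \<bar>(t - dist x y) / (t - s) - (t - dist x z) / (t - s)\<bar>"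
      unfolding f_def by linarith
    also have "\<dots> = \<bar>dist x z - dist x y\<bar> / (t - s)"
      using \<open>s < t\<close> by (simp add: diff_divide_distrib[symmetric])
    also have "\<dots> \<le> dist y z / (t - s)"
      using \<open>s < t\<close> dist_triangle[of x z y] dist_triangle[of x y z]
      by (intro divide_right_mono) (auto simp: dist_commute)
    finally have "\<bar>f y - f z\<bar> \<le> dist y z / (t - s)" .
    moreover have "\<bar>f y - f z\<bar> \<le> 1"
      unfolding f_def by linarith
    ultimately show ?thesis
      by simp
  qed
  have f_outside: "f y = 0" if "y \<notin> ball x t" for y
    using that \<open>s < t\<close> by (simp add: f_def divide_nonpos_pos)
  have f_inside: "f y = 1" if "y \<in> ball x s" for y
    using that \<open>s < t\<close> by (simp add: f_def)
  have lip: "(1 / (t - s))-lipschitz_on UNIV f"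
    using f_diff \<open>s < t\<close> by (intro lipschitz_onI) (auto simp: dist_real_def)
  have supp: "bounded {y. f y \<noteq> 0}"
    using f_outside by (intro bounded_subset[OF bounded_ball[of x t]]) blast
  have f_meas: "f \<in> borel_measurable M"
    using borel_measurable_continuous_onI[OF lipschitz_on_continuous_on[OF lip]]
    by (simp add: measurable_cong_sets[OF sets_eq_borel])
  have "\<bar>f y - f z\<bar> \<le> dist y z powr \<alpha> * (g y + g z)" for y z
  \<comment> \<open>If one of the points lies in \<open>ball x t\<close>, then
    \<open>g y + g z\<close> is at least \<open>(t - s) powr (- \<alpha>)\<close>; otherwise
    \<open>f\<close> vanishes at both. The inequality holds at all points, so the exceptional null
    set can be empty.\<close>
  proof (cases "y \<in> ball x t \<or> z \<in> ball x t")
    case True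
    have "\<bar>f y - f z\<bar> \<le> (dist y z / (t - s)) powr \<alpha>"
      using f_diff[of y z] min_one_le_powr[OF _ \<alpha>, of "dist y z / (t - s)"] \<open>s < t\<close>
      by (meson divide_nonneg_nonneg order_trans diff_ge_0_iff_ge less_imp_le zero_le_dist)
    also have "\<dots> = dist y z powr \<alpha> * (t - s) powr (- \<alpha>)"
      using \<open>s < t\<close> by (simp add: powr_divide powr_minus field_simps)
    also have "\<dots> \<le> dist y z powr \<alpha> * (g y + g z)"
      using True by (intro mult_left_mono) (auto simp: g_def indicator_def)
    finally show ?thesis .
  next
    case False
    then show ?thesis
      using f_outside by (simp add: g_def)
  qed
  moreover have "g \<in> borel_measurable M"
    unfolding g_def by measurable
  ultimately have "g \<in> hajlasz_gradients M \<alpha> f"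
    by (auto simp: hajlasz_gradients_def g_def intro!: bexI[of _ "{}"])
  then have "hajlasz_seminorm M \<alpha> NX f \<le> NX g"
    unfolding hajlasz_seminorm_def by (rule INF_lower)
  also have "NX g = ennreal ((t - s) powr (- \<alpha>)) * NX (indicator (ball x t))"
    unfolding g_def using ball_fmeasurable[of x t]
    by (subst X.homogeneous) (auto intro: X.indicator_in_carrier simp: fmeasurable_def)
  finally have semi: "hajlasz_seminorm M \<alpha> NX f
      \<le> ennreal ((t - s) powr (- \<alpha>)) * NX (indicator (ball x t))" .
  have "NY (indicator (ball x s)) \<le> NY f"
    using f_meas f_inside by (intro Y.lattice) (auto simp: indicator_def)
  also have "\<dots> \<le> ennreal C * hajlasz_seminorm M \<alpha> NX f"
    using lip supp by (intro embed) auto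
  also have "\<dots> \<le> ennreal C * (ennreal ((t - s) powr (- \<alpha>)) * NX (indicator (ball x t)))"
    using semi by (rule mult_left_mono) simp
  also have "\<dots> = ennreal (C * (t - s) powr (- \<alpha>) * fundamental_fun M NX (measure M (ball x t)))"
    using \<open>0 \<le> C\<close>
    by (simp add: X.fundamental_fun_fmeasurable[OF ball_fmeasurable, symmetric] ennreal_mult
        mult.assoc)
  finally have "ennreal (fundamental_fun M NY (measure M (ball x s)))
      \<le> ennreal (C * (t - s) powr (- \<alpha>) * fundamental_fun M NX (measure M (ball x t)))"
    by (simp add: Y.fundamental_fun_fmeasurable[OF ball_fmeasurable])
  then show ?thesis
    using \<open>0 \<le> C\<close> by simp
qed

section \<open>Lower bounds from a recursive inequality\<close>

text \<open>
  Subtracting the affine solution \<open>p - q * j\<close> of the recursion with equality leaves a sequence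
  \<open>u\<close> with \<open>u j \<ge> (1 - \<beta>) * u (j + 1)\<close> that is bounded below.
\<close>

lemma recursive_lower_bound:
  fixes L :: "nat \<Rightarrow> real"
  assumes \<beta>: "0 < \<beta>" "\<beta> \<le> 1" and "0 \<le> B"
    and rec: "\<And>j. L j \<ge> A - B * real j + (1 - \<beta>) * L (Suc j)"
    and bound: "\<And>j. L j \<ge> m"
  shows "L 0 \<ge> A / \<beta> - (1 - \<beta>) * B / \<beta>\<^sup>2"
proof -
  \<comment> \<open>Inserting \<open>p - q * j\<close> into the recursion with equality and
    comparing coefficients gives \<open>q * \<beta> = B\<close> and
    \<open>p * \<beta> = A - (1 - \<beta>) * q\<close>.\<close>
  define q where "q = B / \<beta>"
  define p where "p = A / \<beta> - (1 - \<beta>) * B / \<beta>\<^sup>2"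
  define u where "u j = L j - (p - q * real j)" for j
  have "0 \<le> q"
    using assms by (simp add: q_def)
  have q: "q * \<beta> = B" and p: "p * \<beta> = A - (1 - \<beta>) * q"
    using \<beta> by (simp_all add: p_def q_def field_simps power2_eq_square)
  have u_rec: "u j \<ge> (1 - \<beta>) * u (Suc j)" for j
  proof -
    have "(p - q * real j) - (1 - \<beta>) * (p - q * real (Suc j))
        = p * \<beta> - (q * \<beta>) * real j + (1 - \<beta>) * q"
      by (simp add: algebra_simps)
    also have "\<dots> = A - B * real j"
      using p q by simp
    finally show ?thesis
      using rec[of j] by (simp add: u_def algebra_simps)
  qed
  have u0: "u 0 \<ge> (1 - \<beta>) ^ n * u n" for n
  proof (induction n)
    case (Suc n)
    have "(1 - \<beta>) ^ n * ((1 - \<beta>) * u (Suc n)) \<le> (1 - \<beta>) ^ n * u n"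
      using \<beta> u_rec by (intro mult_left_mono) auto
    then show ?case
      using Suc by (simp add: mult_ac)
  qed simp
  \<comment> \<open>The term \<open>q * n\<close> in \<open>u n\<close> is nonnegative, so the lower
    bound \<open>m\<close> for \<open>L\<close> yields the lower bound \<open>m - p\<close> for
    \<open>u\<close>, uniformly in \<open>n\<close>.\<close>
  have "u 0 \<ge> (1 - \<beta>) ^ n * (m - p)" for n
  proof -
    have "m - p \<le> u n"
      using bound[of n] \<open>0 \<le> q\<close> by (simp add: u_def add_increasing2)
    then have "(1 - \<beta>) ^ n * (m - p) \<le> (1 - \<beta>) ^ n * u n"
      using \<beta> by (intro mult_left_mono) auto
    then show ?thesis
      using u0[of n] by linarith
  qed
  moreover have "(\<lambda>n. (1 - \<beta>) ^ n * (m - p)) \<longlonglongrightarrow> 0"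
    using \<beta> by (intro tendsto_mult_left_zero LIMSEQ_realpow_zero) auto
  ultimately have "u 0 \<ge> 0"
    by (intro LIMSEQ_le_const2) auto
  then show ?thesis
    by (simp add: u_def p_def)
qed

text \<open>Logarithms turn the recursion into the affine one. The conclusion is free of
  \<open>m\<close>, which may therefore depend on the sequence, here on the ball, without spoiling
  uniformity.\<close>

lemma geometric_recursion_lower_bound:
  fixes a :: "nat \<Rightarrow> real"
  assumes \<beta>: "0 < \<beta>" "\<beta> \<le> 1" and "0 \<le> \<alpha>" "0 < K" "0 < r" "0 < m"
    and rec: "\<And>j. a j \<ge> K * (r / 2 ^ (j + 2)) powr \<alpha> * a (Suc j) powr (1 - \<beta>)"
    and bound: "\<And>j. a j \<ge> m"
  shows "a 0 \<ge> exp ((ln K - 2 * \<alpha> * ln 2) / \<beta> - (1 - \<beta>) * (\<alpha> * ln 2) / \<beta>\<^sup>2) * r powr (\<alpha> / \<beta>)"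
proof -
  have pos: "0 < a j" for j
    using bound[of j] \<open>0 < m\<close> by linarith
  \<comment> \<open>The dyadic factor \<open>2 ^ (j + 2)\<close> contributes the slope
    \<open>B = \<alpha> * ln 2\<close> and the constant \<open>2 * \<alpha> * ln 2\<close> in
    \<open>A\<close>. Since \<open>A\<close> is divided by \<beta>, \<open>ln r\<close> acquires the
    coefficient \<open>\<alpha> / \<beta>\<close>.\<close>
  have "ln (a 0) \<ge> (ln K + \<alpha> * ln r - 2 * \<alpha> * ln 2) / \<beta> - (1 - \<beta>) * (\<alpha> * ln 2) / \<beta>\<^sup>2"
  proof (rule recursive_lower_bound[where m = "ln m"])
    fix j
    have "ln (K * (r / 2 ^ (j + 2)) powr \<alpha> * a (Suc j) powr (1 - \<beta>)) \<le> ln (a j)"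
      using rec[of j] pos[of "Suc j"] pos[of j] assms by (subst ln_le_cancel_iff) auto
    also have "ln (K * (r / 2 ^ (j + 2)) powr \<alpha> * a (Suc j) powr (1 - \<beta>))
        = ln K + \<alpha> * (ln r - real (j + 2) * ln 2) + (1 - \<beta>) * ln (a (Suc j))"
      using pos[of "Suc j"] assms
      by (simp add: ln_mult ln_powr ln_div ln_realpow del: power_Suc power_add of_nat_add)
    finally show "ln (a j) \<ge> (ln K + \<alpha> * ln r - 2 * \<alpha> * ln 2) - \<alpha> * ln 2 * real j
        + (1 - \<beta>) * ln (a (Suc j))"
      by (simp add: algebra_simps)
    show "ln (a j) \<ge> ln m"
      using bound[of j] \<open>0 < m\<close> by simp
  qed (use assms in auto)
  then have "(ln K - 2 * \<alpha> * ln 2) / \<beta> - (1 - \<beta>) * (\<alpha> * ln 2) / \<beta>\<^sup>2 + \<alpha> / \<beta> * ln r \<le> ln (a 0)"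
    by (simp add: add_divide_distrib diff_divide_distrib)
  then have "exp ((ln K - 2 * \<alpha> * ln 2) / \<beta> - (1 - \<beta>) * (\<alpha> * ln 2) / \<beta>\<^sup>2 + \<alpha> / \<beta> * ln r) \<le> a 0"
    using pos[of 0] by (metis exp_le_cancel_iff exp_ln)
  then show ?thesis
    using \<open>0 < r\<close> by (simp add: exp_add powr_def)
qed

section \<open>Estimates along shrinking radii and the growth of balls\<close>

theorem proposition13:
  fixes M :: "'a::metric_space measure"
    and NX NY :: "('a \<Rightarrow> real) \<Rightarrow> ennreal"
    and \<alpha> :: real
  defines "a \<equiv> \<lambda>x r j. measure M (ball x (radius_seq r j))"
    and "\<delta> \<equiv> \<lambda>r j. radius_seq r j - radius_seq r (Suc j)"
    and "\<phi>X \<equiv> fundamental_fun M NX"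
    and "\<phi>Y \<equiv> fundamental_fun M NY"
  assumes "metric_measure_space M"
    and "ri_space M NX" and "ri_space M NY"
    and "0 < \<alpha>" and "\<alpha> \<le> 1"
    and "\<exists>C>0::real. \<forall>f :: 'a \<Rightarrow> real.
           (\<exists>L. L-lipschitz_on UNIV f) \<longrightarrow> bounded {x. f x \<noteq> 0} \<longrightarrow>
           NY f \<le> ennreal C * hajlasz_seminorm M \<alpha> NX f"
  shows "(\<exists>C1>0::real. \<exists>c1>0::real. \<forall>x. \<forall>r>0. \<forall>j.
            \<phi>Y (a x r (Suc j)) \<le> C1 * \<delta> r j powr (-\<alpha>) * \<phi>X (a x r j) \<and>
            a x r j \<ge> c1 * \<delta> r j powr \<alpha> * a x r (Suc j) *
                        (\<phi>Y (a x r (Suc j)) / \<phi>X (a x r (Suc j)))) \<and>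
         (\<forall>\<beta> c :: real. 0 < \<beta> \<longrightarrow> \<beta> \<le> 1 \<longrightarrow> c > 0 \<longrightarrow>
            (\<forall>t>0. \<phi>Y t \<ge> c * t powr (-\<beta>) * \<phi>X t) \<longrightarrow>
            (\<exists>c'>0. \<forall>r>0. h_mu M r \<ge> c' * r powr (\<alpha> / \<beta>))) \<and>
         (\<forall>\<beta> c t0 :: real. 0 < \<beta> \<longrightarrow> \<beta> \<le> 1 \<longrightarrow> c > 0 \<longrightarrow> t0 > 0 \<longrightarrow>
            (\<forall>t. 0 < t \<longrightarrow> t \<le> t0 \<longrightarrow> \<phi>Y t \<ge> c * t powr (-\<beta>) * \<phi>X t) \<longrightarrow>
            (\<exists>c'>0. \<forall>r. 0 < r \<longrightarrow> r \<le> 1 \<longrightarrow> h_mu M r \<ge> c' * r powr (\<alpha> / \<beta>)))"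
proof -
  interpret metric_measure_space M by fact
  interpret X: ri_space M NX by fact
  obtain C :: real where C: "C > 0" and embed: "\<forall>f :: 'a \<Rightarrow> real.
      (\<exists>L. L-lipschitz_on UNIV f) \<longrightarrow> bounded {x. f x \<noteq> 0} \<longrightarrow>
      NY f \<le> ennreal C * hajlasz_seminorm M \<alpha> NX f"
    using assms(10) by blast
  have \<delta>_eq: "\<delta> r j = r / 2 ^ (j + 2)" for r j
    by (simp only: \<delta>_def radius_seq_diff)
  have \<delta>_pos: "0 < \<delta> r j" if "0 < r" for r j
    using that by (simp add: \<delta>_eq)
  have radius_ge: "r / 2 \<le> radius_seq r j" if "0 < r" for r j
    using that by (simp add: radius_seq_def)
  have a_lower: "measure M (ball x (r / 2)) \<le> a x r j" if "0 < r" for x r j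
    unfolding a_def using radius_ge[OF that, of j] ball_fmeasurable
    by (intro measure_mono_fmeasurable) auto
  have a_pos: "0 < a x r j" if "0 < r" for x r j
    using a_lower[OF that, of x j] measure_ball_pos[of "r / 2" x] that by linarith
  have a_mono: "a x r (Suc j) \<le> a x r j" if "0 < r" for x r j
    unfolding a_def using \<delta>_pos[OF that, of j] ball_fmeasurable
    by (intro measure_mono_fmeasurable) (auto simp: \<delta>_def)
  have a_le_0: "a x r j \<le> a x r 0" if "0 < r" for x r j
    by (induction j) (use a_mono[OF that] order_trans in blast)+
  have a_0: "a x r 0 = measure M (ball x r)" for x r
    by (simp add: a_def radius_seq_def)
  have first: "\<phi>Y (a x r (Suc j)) \<le> C * \<delta> r j powr (- \<alpha>) * \<phi>X (a x r j)" if "0 < r" for x r j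
    unfolding \<phi>X_def \<phi>Y_def a_def \<delta>_def
    using C embed \<delta>_pos[OF that, of j]
    by (intro fundamental_fun_ball_le assms) (auto simp: \<delta>_def)
  have \<phi>X_pos: "0 < \<phi>X (a x r j)" if "0 < r" for x r j
    unfolding \<phi>X_def using a_pos[OF that] unfolding a_def
    by (intro X.fundamental_fun_pos ball_fmeasurable)
  \<comment> \<open>In the constant \<open>1 / (2 * C)\<close>, the 2 comes from approximate
    quasi-concavity and \<open>C\<close> from the first estimate.\<close>
  have second: "a x r j \<ge> 1 / (2 * C) * \<delta> r j powr \<alpha> * a x r (Suc j) *
      (\<phi>Y (a x r (Suc j)) / \<phi>X (a x r (Suc j)))" if "0 < r" for x r j
  proof -
    have "\<phi>X (a x r j) \<le> 2 * (a x r j / a x r (Suc j)) * \<phi>X (a x r (Suc j))"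
      unfolding \<phi>X_def using a_pos[OF that, of x "Suc j"] a_mono[OF that, of x j] unfolding a_def
      by (intro fundamental_fun_quasi_concave ball_fmeasurable assms)
    then have "C * \<delta> r j powr (- \<alpha>) * \<phi>X (a x r j)
        \<le> C * \<delta> r j powr (- \<alpha>) * (2 * (a x r j / a x r (Suc j)) * \<phi>X (a x r (Suc j)))"
      using C by (intro mult_left_mono) auto
    with first[OF that, of x j]
    have "\<phi>Y (a x r (Suc j))
        \<le> C * \<delta> r j powr (- \<alpha>) * (2 * (a x r j / a x r (Suc j)) * \<phi>X (a x r (Suc j)))"
      by linarith
    then show ?thesis
      using C a_pos[OF that, of x "Suc j"] \<phi>X_pos[OF that, of x "Suc j"] \<delta>_pos[OF that, of j]
      by (simp add: powr_minus field_simps)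
  qed
  \<comment> \<open>Growth is required only for \<open>t\<close> up to the measure of the ball, so
    both the global and the local hypothesis can be fed in. The constant \<open>c'\<close> is chosen
    before \<open>x\<close> and \<open>r\<close>.\<close>
  have ball_bound: "\<exists>c'>0. \<forall>x. \<forall>r>0. (\<forall>t. 0 < t \<longrightarrow> t \<le> measure M (ball x r) \<longrightarrow>
      \<phi>Y t \<ge> c * t powr (- \<beta>) * \<phi>X t) \<longrightarrow> c' * r powr (\<alpha> / \<beta>) \<le> measure M (ball x r)"
    if \<beta>: "0 < \<beta>" "\<beta> \<le> 1" and c: "c > 0" for \<beta> c :: real
  proof -
    define K where "K = c / (2 * C)"
    show ?thesis
    proof (intro exI conjI allI impI)
      show "0 < exp ((ln K - 2 * \<alpha> * ln 2) / \<beta> - (1 - \<beta>) * (\<alpha> * ln 2) / \<beta>\<^sup>2)"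
        by simp
      fix x r
      assume r: "0 < (r :: real)"
        and growth: "\<forall>t. 0 < t \<longrightarrow> t \<le> measure M (ball x r) \<longrightarrow> \<phi>Y t \<ge> c * t powr (- \<beta>) * \<phi>X t"
      have "exp ((ln K - 2 * \<alpha> * ln 2) / \<beta> - (1 - \<beta>) * (\<alpha> * ln 2) / \<beta>\<^sup>2) * r powr (\<alpha> / \<beta>) \<le> a x r 0"
      proof (rule geometric_recursion_lower_bound[where a = "a x r" and m = "measure M (ball x (r / 2))"])
        fix j
        let ?t = "a x r (Suc j)"
        \<comment> \<open>All measures in the recursion stay below that of the full ball, hence
          within the range of the growth condition.\<close>
        have t: "0 < ?t" "?t \<le> measure M (ball x r)"
          using a_pos[OF r] a_le_0[OF r] a_0 by metis+
        then have "c * ?t powr (- \<beta>) * \<phi>X ?t \<le> \<phi>Y ?t"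
          using growth by blast
        then have "c * ?t powr (- \<beta>) \<le> \<phi>Y ?t / \<phi>X ?t"
          using \<phi>X_pos[OF r] by (simp add: pos_le_divide_eq)
        then have "1 / (2 * C) * \<delta> r j powr \<alpha> * ?t * (c * ?t powr (- \<beta>))
            \<le> 1 / (2 * C) * \<delta> r j powr \<alpha> * ?t * (\<phi>Y ?t / \<phi>X ?t)"
          using C t(1) by (intro mult_left_mono) auto
        then have "1 / (2 * C) * \<delta> r j powr \<alpha> * ?t * (c * ?t powr (- \<beta>)) \<le> a x r j"
          by (rule order_trans[OF _ second[OF r]])
        moreover have "1 / (2 * C) * \<delta> r j powr \<alpha> * ?t * (c * ?t powr (- \<beta>))
            = K * \<delta> r j powr \<alpha> * ?t powr (1 - \<beta>)"
          using t(1) powr_add[of ?t 1 "- \<beta>"] by (simp add: K_def)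
        ultimately show "a x r j \<ge> K * (r / 2 ^ (j + 2)) powr \<alpha> * ?t powr (1 - \<beta>)"
          by (simp only: \<delta>_eq)
        show "a x r j \<ge> measure M (ball x (r / 2))"
          by (rule a_lower[OF r])
      qed (use \<beta> r C c \<open>0 < \<alpha>\<close> measure_ball_pos[of "r / 2" x] in \<open>auto simp: K_def\<close>)
      then show "exp ((ln K - 2 * \<alpha> * ln 2) / \<beta> - (1 - \<beta>) * (\<alpha> * ln 2) / \<beta>\<^sup>2) * r powr (\<alpha> / \<beta>)
          \<le> measure M (ball x r)"
        by (simp only: a_0)
    qed
  qed
  show ?thesis
  proof (intro conjI allI impI)
    show "\<exists>C1>0::real. \<exists>c1>0::real. \<forall>x. \<forall>r>0. \<forall>j.
        \<phi>Y (a x r (Suc j)) \<le> C1 * \<delta> r j powr (-\<alpha>) * \<phi>X (a x r j) \<and>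
        a x r j \<ge> c1 * \<delta> r j powr \<alpha> * a x r (Suc j) * (\<phi>Y (a x r (Suc j)) / \<phi>X (a x r (Suc j)))"
      using C first second by (intro exI[of _ C] exI[of _ "1 / (2 * C)"] conjI) auto
  next
    fix \<beta> c :: real
    assume *: "0 < \<beta>" "\<beta> \<le> 1" "c > 0" and growth: "\<forall>t>0. \<phi>Y t \<ge> c * t powr (-\<beta>) * \<phi>X t"
    obtain c' where "c' > 0" "\<And>x r. r > 0 \<Longrightarrow> c' * r powr (\<alpha> / \<beta>) \<le> measure M (ball x r)"
      using ball_bound[OF *] growth by blast
    then show "\<exists>c'>0. \<forall>r>0. h_mu M r \<ge> c' * r powr (\<alpha> / \<beta>)"
      unfolding h_mu_def by (intro exI[of _ c']) (auto intro!: cINF_greatest)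
  next
    fix \<beta> c t0 :: real
    assume *: "0 < \<beta>" "\<beta> \<le> 1" "c > 0" and "t0 > 0"
      and growth: "\<forall>t. 0 < t \<longrightarrow> t \<le> t0 \<longrightarrow> \<phi>Y t \<ge> c * t powr (-\<beta>) * \<phi>X t"
    obtain c' where c': "c' > 0" and
      small: "\<And>x r. r > 0 \<Longrightarrow> measure M (ball x r) \<le> t0 \<Longrightarrow> c' * r powr (\<alpha> / \<beta>) \<le> measure M (ball x r)"
      using ball_bound[OF *] growth by (meson order_trans)
    \<comment> \<open>A ball of measure above \<open>t0\<close> lies outside the range of the growth
      condition, but for \<open>r \<le> 1\<close> its measure exceeds
      \<open>t0 * r powr (\<alpha> / \<beta>)\<close> anyway; this explains the minimum.\<close>
    have "min c' t0 * r powr (\<alpha> / \<beta>) \<le> measure M (ball x r)" if r: "0 < r" "r \<le> 1" for x r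
    proof (cases "measure M (ball x r) \<le> t0")
      case True
      have "min c' t0 * r powr (\<alpha> / \<beta>) \<le> c' * r powr (\<alpha> / \<beta>)"
        by (intro mult_right_mono) auto
      then show ?thesis
        using small[OF r(1) True] by linarith
    next
      case False
      have "r powr (\<alpha> / \<beta>) \<le> 1"
        using r * \<open>0 < \<alpha>\<close> by (intro powr_le1) auto
      then have "min c' t0 * r powr (\<alpha> / \<beta>) \<le> t0 * 1"
        using c' \<open>t0 > 0\<close> by (intro mult_mono) auto
      then show ?thesis
        using False by linarith
    qed
    then show "\<exists>c'>0. \<forall>r. 0 < r \<longrightarrow> r \<le> 1 \<longrightarrow> h_mu M r \<ge> c' * r powr (\<alpha> / \<beta>)"
      unfolding h_mu_def using c' \<open>t0 > 0\<close>
      by (intro exI[of _ "min c' t0"]) (auto intro!: cINF_greatest)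
  qed
qed

end
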